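(* Let $K$ be a nonempty closed convex cone in a finite-dimensional Euclidean space such that $K$ and its dual cone $K^*$ are both exposed, and let $L$ be an affine subspace with $L\cap K\neq\emptyset$. If $f$ is a longest FR sequence for $L\cap K$ (i.e. an FR sequence whose length equals the maximum length among all FR sequences for $L\cap K$), then $f$ is minimal.
   Context: Notation. $K^*=\{y\mid\langle y,x\rangle\ge 0\ \forall x\in K\}$. For a set $S$, $S^\perp=\{y\mid \langle y,x\rangle=0\ \forall x\in S\}$ (also when $S$ is an affine subspace), and $w^\perp:=\{w\}^\perp$. A nonempty convex subcone $F\subseteq K$ is a face of $K$, written $F\unlhd K$, if $x,y\in K$ and $x+y\in F$ imply $x,y\in F$. A face $F$ of $K$ is exposed if $F=K\cap v^\perp$ for some $v\in K^*$; a cone is exposed if all of its (nonempty) faces are exposed. FR sequences. Facial reduction for $L\cap K$: set $F_0=K$; for $i=1,2,\dots$, as long as $L^\perp\cap(F_{i-1}^*\setminus F_{i-1}^\perp)\neq\emptyset$, choose any $w_i\in L^\perp\cap(F_{i-1}^*\setminus F_{i-1}^\perp)$ and set $F_i=F_{i-1}\cap w_i^\perp$. The procedure is run until it terminates, i.e. until $L^\perp\cap(F_d^*\setminus F_d^\perp)=\emptyset$, at which point $F_d$ is the minimal face of $L\cap K$ (the smallest face of $K$ containing $L\cap K$). The resulting $(w_1,\dots,w_d)$ is called an FR sequence for $L\cap K$, of length $d$, with corresponding sequence of faces $(F_0,\dots,F_d)$, where $F_0\supsetneq F_1\supsetneq\cdots\supsetneq F_d$. If the procedure terminates immediately, $d=0$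 (empty sequence). Minimality. For a face $F\unlhd K$, a vector $w$ is minimal for $L\cap F$ if $w\in L^\perp\cap(F^*\setminus F^\perp)$ and there is no $u\in L^\perp\cap(F^*\setminus F^\perp)$ with $F\cap w^\perp\subsetneq F\cap u^\perp$. An FR sequence $(w_1,\dots,w_d)$ with faces $(F_0,\dots,F_d)$ is minimal if $w_i$ is minimal for $L\cap F_{i-1}$ for all $i=1,\dots,d$. *)

theory Defs
  imports "HOL-Analysis.Analysis"
begin

definition dual_cone :: "'a::euclidean_space set \<Rightarrow> 'a set" where
  "dual_cone K = {y. \<forall>x\<in>K. y \<bullet> x \<ge> 0}"

text \<open>Faces of cones in the additive sense. Unlike the library's \<open>face_of\<close>, a cone face
  is nonempty (\<open>convex_cone\<close> includes nonemptiness) and is itself a cone.\<close>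

definition cone_face :: "'a::euclidean_space set \<Rightarrow> 'a set \<Rightarrow> bool" where
  "cone_face F K \<longleftrightarrow> convex_cone F \<and> F \<subseteq> K \<and>
     (\<forall>x\<in>K. \<forall>y\<in>K. x + y \<in> F \<longrightarrow> x \<in> F \<and> y \<in> F)"

definition exposed_cone_face :: "'a::euclidean_space set \<Rightarrow> 'a set \<Rightarrow> bool" where
  "exposed_cone_face F K \<longleftrightarrow> cone_face F K \<and> (\<exists>v\<in>dual_cone K. F = K \<inter> {v}\<^sup>\<bottom>)"

definition exposed_cone :: "'a::euclidean_space set \<Rightarrow> bool" where
  "exposed_cone K \<longleftrightarrow> (\<forall>F. cone_face F K \<longrightarrow> exposed_cone_face F K)"

text \<open>The admissible choices at face \<open>F\<close>. Note that \<open>L\<^sup>\<bottom>\<close> is taken with respect to the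
  points of \<open>L\<close> (not its direction space), and \<open>L\<close> need not contain the origin.\<close>

definition reducing_vectors :: "'a::euclidean_space set \<Rightarrow> 'a set \<Rightarrow> 'a set" where
  "reducing_vectors L F = L\<^sup>\<bottom> \<inter> (dual_cone F - F\<^sup>\<bottom>)"

text \<open>\<open>fr_face K ws i\<close> is $F_i$. List indices start at 0, so $w_{i+1}$ is \<open>ws ! i\<close>;
  the value is only meaningful for \<open>i \<le> length ws\<close>.\<close>

primrec fr_face :: "'a::euclidean_space set \<Rightarrow> 'a list \<Rightarrow> nat \<Rightarrow> 'a set" where
  "fr_face K ws 0 = K"
| "fr_face K ws (Suc i) = fr_face K ws i \<inter> {ws ! i}\<^sup>\<bottom>"

text \<open>The second conjunct says that the procedure has been run until it terminates.\<close>

definition fr_sequence :: "'a::euclidean_space set \<Rightarrow> 'a set \<Rightarrow> 'a list \<Rightarrow> bool" where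
  "fr_sequence L K ws \<longleftrightarrow>
     (\<forall>i<length ws. ws ! i \<in> reducing_vectors L (fr_face K ws i)) \<and>
     reducing_vectors L (fr_face K ws (length ws)) = {}"

definition longest_fr_sequence :: "'a::euclidean_space set \<Rightarrow> 'a set \<Rightarrow> 'a list \<Rightarrow> bool" where
  "longest_fr_sequence L K ws \<longleftrightarrow>
     fr_sequence L K ws \<and> (\<forall>vs. fr_sequence L K vs \<longrightarrow> length vs \<le> length ws)"

definition minimal_for :: "'a::euclidean_space set \<Rightarrow> 'a set \<Rightarrow> 'a \<Rightarrow> bool" where
  "minimal_for L F w \<longleftrightarrow> w \<in> reducing_vectors L F \<and>
     \<not> (\<exists>u\<in>reducing_vectors L F. F \<inter> {w}\<^sup>\<bottom> \<subset> F \<inter> {u}\<^sup>\<bottom>)"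

definition minimal_fr_sequence :: "'a::euclidean_space set \<Rightarrow> 'a set \<Rightarrow> 'a list \<Rightarrow> bool" where
  "minimal_fr_sequence L K ws \<longleftrightarrow>
     fr_sequence L K ws \<and> (\<forall>i<length ws. minimal_for L (fr_face K ws i) (ws ! i))"

end

theory Submission
  imports Defs
begin

text \<open>
  If a step of an FR sequence is not minimal, the sequence can be lengthened by one. Suppose that
  the step from a face \<open>F\<close> to \<open>F \<inter> {w}\<^sup>\<bottom>\<close> is not minimal, because some reducing vector \<open>u\<close>
  gives a strictly larger face \<open>F \<inter> {u}\<^sup>\<bottom>\<close>. Then insert \<open>u\<close> just before \<open>w\<close>: the step by \<open>w\<close>
  still makes progress after the step by \<open>u\<close>, and it lands on \<open>F \<inter> {u}\<^sup>\<bottom> \<inter> {w}\<^sup>\<bottom> = F \<inter> {w}\<^sup>\<bottom>\<close>,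
  the very face reached without the detour (\<open>reducing_vector_after_coarser_step\<close>). Hence the rest
  of the sequence remains valid and terminates at the same face
  (\<open>fr_sequence_insert_coarser_step\<close>). In a longest sequence no such insertion is possible, so
  every step is minimal.
\<close>

text \<open>Splitting off the first step turns facial reduction into a recursion over the starting
  cone, whereas \<open>fr_face\<close> itself recurses on the last step. Inserting a vector into the sequence
  shifts all later indices, so the recursion from the front is the one suited to induction.\<close>

lemma fr_face_Cons: "fr_face K (w # ws) (Suc i) = fr_face (K \<inter> {w}\<^sup>\<bottom>) ws i"
  by (induction i) simp_all

lemma fr_sequence_Cons:
  "fr_sequence L K (w # ws) \<longleftrightarrow>
     w \<in> reducing_vectors L K \<and> fr_sequence L (K \<inter> {w}\<^sup>\<bottom>) ws"
  unfolding fr_sequence_def length_Cons All_less_Suc2 fr_face_Cons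
  by simp

text \<open>The dual cone only grows when \<open>F\<close> shrinks to \<open>F \<inter> {u}\<^sup>\<bottom>\<close>, and a point of \<open>F \<inter> {u}\<^sup>\<bottom>\<close>
  outside \<open>F \<inter> {w}\<^sup>\<bottom>\<close> witnesses that \<open>w\<close> does not vanish on the smaller face.\<close>

lemma reducing_vector_after_coarser_step:
  assumes w: "w \<in> reducing_vectors L F"
    and coarser: "F \<inter> {w}\<^sup>\<bottom> \<subset> F \<inter> {u}\<^sup>\<bottom>"
  shows "w \<in> reducing_vectors L (F \<inter> {u}\<^sup>\<bottom>)"
    and "F \<inter> {u}\<^sup>\<bottom> \<inter> {w}\<^sup>\<bottom> = F \<inter> {w}\<^sup>\<bottom>"
proof -
  obtain x where x: "x \<in> F \<inter> {u}\<^sup>\<bottom>" and "x \<notin> {w}\<^sup>\<bottom>"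
    using coarser by blast
  then have "\<not> orthogonal x w"
    by (simp add: orthogonal_comp_def orthogonal_commute)
  with x have "w \<notin> (F \<inter> {u}\<^sup>\<bottom>)\<^sup>\<bottom>"
    unfolding orthogonal_comp_def[of "F \<inter> {u}\<^sup>\<bottom>"] by blast
  with w show "w \<in> reducing_vectors L (F \<inter> {u}\<^sup>\<bottom>)"
    by (simp add: reducing_vectors_def dual_cone_def)
  show "F \<inter> {u}\<^sup>\<bottom> \<inter> {w}\<^sup>\<bottom> = F \<inter> {w}\<^sup>\<bottom>"
    using coarser by blast
qed

lemma fr_sequence_insert_coarser_step:
  assumes "fr_sequence L K ws" and "i < length ws"
    and "u \<in> reducing_vectors L (fr_face K ws i)"
    and "fr_face K ws i \<inter> {ws ! i}\<^sup>\<bottom> \<subset> fr_face K ws i \<inter> {u}\<^sup>\<bottom>"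
  shows "fr_sequence L K (take i ws @ u # drop i ws)"
  using assms
proof (induction i arbitrary: K ws)
  case 0
  then obtain w vs where ws: "ws = w # vs"
    by (cases ws) auto
  with 0 show ?case
    using reducing_vector_after_coarser_step[of w L K u]
    by (simp add: fr_sequence_Cons)
next
  case (Suc i)
  then obtain w vs where ws: "ws = w # vs"
    by (cases ws) auto
  have "fr_sequence L (K \<inter> {w}\<^sup>\<bottom>) (take i vs @ u # drop i vs)"
    using Suc.prems unfolding ws fr_face_Cons fr_sequence_Cons
    by (intro Suc.IH) simp_all
  then show ?case
    using Suc.prems(1) by (simp add: ws fr_sequence_Cons)
qed

theorem theorem3p1:
  fixes K L :: "'a::euclidean_space set" and f :: "'a list"
  assumes "convex_cone K" and "closed K"
    and "exposed_cone K" and "exposed_cone (dual_cone K)"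
    and "affine L" and "L \<inter> K \<noteq> {}"
    and "longest_fr_sequence L K f"
  shows "minimal_fr_sequence L K f"
proof -
  have fr: "fr_sequence L K f"
    and longest: "\<And>vs. fr_sequence L K vs \<Longrightarrow> length vs \<le> length f"
    using assms(7) by (auto simp: longest_fr_sequence_def)
  have "minimal_for L (fr_face K f i) (f ! i)" if i: "i < length f" for i
  proof (rule ccontr)
    assume "\<not> minimal_for L (fr_face K f i) (f ! i)"
    then obtain u where "u \<in> reducing_vectors L (fr_face K f i)"
      and "fr_face K f i \<inter> {f ! i}\<^sup>\<bottom> \<subset> fr_face K f i \<inter> {u}\<^sup>\<bottom>"
      using fr i by (auto simp: minimal_for_def fr_sequence_def)
    then have "fr_sequence L K (take i f @ u # drop i f)"
      by (rule fr_sequence_insert_coarser_step[OF fr i])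
    from longest[OF this] i show False
      by simp
  qed
  with fr show ?thesis
    by (simp add: minimal_fr_sequence_def)
qed

end
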